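(* Let $G$ be a finite simple $(P_6,\text{bull})$-free graph. Then $\chi(G)\le \omega(G)^7$.
   Context: $P_6$ is the path on 6 vertices; "free" means no induced subgraph isomorphic to the listed graphs. The bull is the graph consisting of a triangle together with two pendant edges attached at two distinct vertices of the triangle. *)

theory Defs
  imports "Graph_Theory.Graph_Theory"
begin

text \<open>
  Finite simple graphs are the objects of the locale \<open>graph\<close> of \<^theory>\<open>Graph_Theory.Digraph\<close>:
  finite loopless symmetric digraphs without parallel arcs, so that an undirected edge
  is represented by its two orientations. The null graph is a graph in this sense.
\<close>

definition induced_free :: "('a, 'b) pre_digraph \<Rightarrow> ('c, 'd) pre_digraph \<Rightarrow> bool" where
  "induced_free G H \<longleftrightarrow> \<not> (\<exists>S. induced_subgraph S G \<and> digraph_iso H S)"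

text \<open>The path on \<open>n\<close> vertices (not \<open>n\<close> edges).\<close>

definition path_graph :: "nat \<Rightarrow> nat pair_pre_digraph" where
  "path_graph n = mk_symmetric (with_proj
     \<lparr> pverts = {..<n}, parcs = {(i, Suc i) | i. Suc i < n} \<rparr>)"

text \<open>Triangle \<open>0, 1, 2\<close> with pendant vertices \<open>3\<close> and \<open>4\<close> attached at \<open>0\<close> and \<open>1\<close>.\<close>

definition bull_graph :: "nat pair_pre_digraph" where
  "bull_graph = mk_symmetric (with_proj
     \<lparr> pverts = {..<5}, parcs = {(0, 1), (1, 2), (0, 2), (0, 3), (1, 4)} \<rparr>)"

definition is_clique :: "('a, 'b) pre_digraph \<Rightarrow> 'a set \<Rightarrow> bool" where
  "is_clique G K \<longleftrightarrow> K \<subseteq> verts G \<and> (\<forall>u\<in>K. \<forall>v\<in>K. u \<noteq> v \<longrightarrow> u \<rightarrow>\<^bsub>G\<^esub> v)"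

definition clique_number :: "('a, 'b) pre_digraph \<Rightarrow> nat" where
  "clique_number G = Max {card K | K. is_clique G K}"

definition proper_coloring :: "('a, 'b) pre_digraph \<Rightarrow> nat \<Rightarrow> ('a \<Rightarrow> nat) \<Rightarrow> bool" where
  "proper_coloring G k c \<longleftrightarrow> c \<in> verts G \<rightarrow> {..<k} \<and> (\<forall>u v. u \<rightarrow>\<^bsub>G\<^esub> v \<longrightarrow> c u \<noteq> c v)"

definition chromatic_number :: "('a, 'b) pre_digraph \<Rightarrow> nat" where
  "chromatic_number G = (LEAST k. \<exists>c. proper_coloring G k c)"

lemma not_induced_free_iff:
  assumes "graph G" and "graph H"
  shows "\<not> induced_free G H \<longleftrightarrow>
    (\<exists>f. inj_on f (verts H) \<and> f ` verts H \<subseteq> verts G \<and>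
      (\<forall>u\<in>verts H. \<forall>v\<in>verts H. u \<rightarrow>\<^bsub>H\<^esub> v \<longleftrightarrow> f u \<rightarrow>\<^bsub>G\<^esub> f v))" (is "?L \<longleftrightarrow> ?R")
proof
  interpret G: graph G by fact
  interpret H: graph H by fact
  {
    assume ?L
    then obtain S h where S: "induced_subgraph S G" and h: "H.digraph_isomorphism h"
      and SH: "S = app_iso h H"
      by (auto simp: induced_free_def digraph_iso_def)
    have sub: "verts S \<subseteq> verts G" "tail S = tail G" "head S = head G"
      and arcsS: "arcs S = {e \<in> arcs G. tail G e \<in> verts S \<and> head G e \<in> verts S}"
      using S by (auto simp: induced_subgraph_def subgraph_def compatible_def)
    have inj: "inj_on (iso_verts h) (verts H)"
      using h by (simp add: H.digraph_isomorphism_def)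
    have "u \<rightarrow>\<^bsub>H\<^esub> v \<longleftrightarrow> iso_verts h u \<rightarrow>\<^bsub>G\<^esub> iso_verts h v"
      if uv: "u \<in> verts H" "v \<in> verts H" for u v
    proof
      assume "u \<rightarrow>\<^bsub>H\<^esub> v"
      then obtain e where e: "e \<in> arcs H" "tail H e = u" "head H e = v"
        by (rule reachableE)
      then have "iso_arcs h e \<in> arcs S"
        by (simp add: SH)
      then have "iso_arcs h e \<in> arcs G"
        using arcsS by blast
      moreover have "tail G (iso_arcs h e) = iso_verts h u" "head G (iso_arcs h e) = iso_verts h v"
        using h e by (auto simp: H.digraph_isomorphism_def sub(2,3)[symmetric] SH)
      ultimately show "iso_verts h u \<rightarrow>\<^bsub>G\<^esub> iso_verts h v"
        by (auto simp: arcs_ends_conv image_iff intro!: bexI[of _ "iso_arcs h e"])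
    next
      assume "iso_verts h u \<rightarrow>\<^bsub>G\<^esub> iso_verts h v"
      then obtain e where e: "e \<in> arcs G" "tail G e = iso_verts h u" "head G e = iso_verts h v"
        by (rule reachableE)
      then have "e \<in> arcs S"
        using uv unfolding arcsS by (simp add: SH)
      then obtain e' where e': "e' \<in> arcs H" "e = iso_arcs h e'"
        by (auto simp: SH)
      have "iso_verts h (tail H e') = iso_verts h u" "iso_verts h (head H e') = iso_verts h v"
        using h e e' by (auto simp: H.digraph_isomorphism_def sub(2,3)[symmetric] SH)
      then have "tail H e' = u" "head H e' = v"
        using inj uv e'(1) by (auto dest: inj_onD)
      then show "u \<rightarrow>\<^bsub>H\<^esub> v"
        using e'(1) by (auto simp: arcs_ends_conv image_iff intro!: bexI[of _ e'])
    qed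
    moreover have "iso_verts h ` verts H \<subseteq> verts G"
      using sub(1) by (simp add: SH)
    ultimately show ?R
      using inj by blast
  }
  {
    assume ?R
    then obtain f where inj: "inj_on f (verts H)" and ran: "f ` verts H \<subseteq> verts G"
      and adj: "\<And>u v. u \<in> verts H \<Longrightarrow> v \<in> verts H \<Longrightarrow> u \<rightarrow>\<^bsub>H\<^esub> v \<longleftrightarrow> f u \<rightarrow>\<^bsub>G\<^esub> f v"
      by blast
    define S where "S = G \<restriction> (f ` verts H)"
    have S: "induced_subgraph S G"
      unfolding S_def using ran by (rule G.induced_induce)
    have "\<exists>e'. e' \<in> arcs G \<and> tail G e' = f (tail H e) \<and> head G e' = f (head H e)"
      if "e \<in> arcs H" for e
    proof -
      have "tail H e \<rightarrow>\<^bsub>H\<^esub> head H e"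
        using that by (auto simp: arcs_ends_conv)
      then have "f (tail H e) \<rightarrow>\<^bsub>G\<^esub> f (head H e)"
        using adj that by simp
      then show ?thesis
        by (auto elim!: reachableE)
    qed
    then obtain g where g: "\<And>e. e \<in> arcs H \<Longrightarrow>
        g e \<in> arcs G \<and> tail G (g e) = f (tail H e) \<and> head G (g e) = f (head H e)"
      by metis
    define h where "h = \<lparr> iso_verts = f, iso_arcs = g, iso_head = head G, iso_tail = tail G \<rparr>"
    have "inj_on g (arcs H)"
    proof (rule inj_onI)
      fix a b assume ab: "a \<in> arcs H" "b \<in> arcs H" "g a = g b"
      then have "f (tail H a) = f (tail H b)" "f (head H a) = f (head H b)"
        using g by metis+
      then have "arc_to_ends H a = arc_to_ends H b"
        using ab(1,2) inj by (auto simp: arc_to_ends_def dest: inj_onD)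
      then show "a = b"
        using ab(1,2) H.no_multi_arcs by blast
    qed
    then have iso: "H.digraph_isomorphism h"
      using inj g H.wf_digraph by (auto simp: H.digraph_isomorphism_def h_def)
    have "g ` arcs H = arcs S"
    proof (intro equalityI subsetI)
      fix e assume "e \<in> g ` arcs H"
      then show "e \<in> arcs S"
        using g by (auto simp: S_def)
    next
      fix e assume "e \<in> arcs S"
      then obtain u v where uv: "e \<in> arcs G" "u \<in> verts H" "v \<in> verts H"
          "tail G e = f u" "head G e = f v"
        by (auto simp: S_def)
      then have "f u \<rightarrow>\<^bsub>G\<^esub> f v"
        by (metis G.dominatesI arc_to_ends_def)
      then have "u \<rightarrow>\<^bsub>H\<^esub> v"
        using adj uv by blast
      then obtain e' where e': "e' \<in> arcs H" "tail H e' = u" "head H e' = v"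
        by (rule reachableE)
      then have "arc_to_ends G (g e') = arc_to_ends G e"
        using g[of e'] uv by (simp add: arc_to_ends_def)
      then have "g e' = e"
        using g e'(1) uv(1) G.no_multi_arcs by blast
      then show "e \<in> g ` arcs H"
        using e'(1) by blast
    qed
    then have "S = app_iso h H"
      by (simp add: app_iso_def h_def S_def induce_subgraph_def)
    then show ?L
      using S iso by (auto simp: induced_free_def digraph_iso_def)
  }
qed

lemma graph_path_graph: "graph (with_proj (path_graph n))"
proof -
  have "finite {(i, Suc i) |i. Suc i < n}"
    by (rule finite_subset[of _ "{..<n} \<times> {..<n}"]) auto
  then show ?thesis
    by unfold_locales
      (auto simp: path_graph_def mk_symmetric_def symmetric_def arc_to_ends_def sym_def)
qed

lemma graph_bull_graph: "graph (with_proj bull_graph)"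
  by unfold_locales
    (auto simp: bull_graph_def mk_symmetric_def symmetric_def arc_to_ends_def intro: symI)

text \<open>\<open>Max\<close> and \<open>LEAST\<close> above are taken over a finite non-empty, respectively non-empty, set.\<close>

lemma clique_number_attained:
  assumes "graph G"
  shows "\<exists>K. is_clique G K \<and> card K = clique_number G"
    and "is_clique G K \<Longrightarrow> card K \<le> clique_number G"
proof -
  interpret graph G by fact
  have "{card K | K. is_clique G K} \<subseteq> card ` Pow (verts G)"
    by (auto simp: is_clique_def)
  then have fin: "finite {card K | K. is_clique G K}"
    by (rule finite_subset) simp
  have "is_clique G {}"
    by (simp add: is_clique_def)
  then have "{card K | K. is_clique G K} \<noteq> {}"
    by blast
  from Max_in[OF fin this] show "\<exists>K. is_clique G K \<and> card K = clique_number G"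
    by (auto simp: clique_number_def)
  show "is_clique G K \<Longrightarrow> card K \<le> clique_number G"
    using fin by (auto simp: clique_number_def intro: Max_ge)
qed

lemma chromatic_number_attained:
  assumes "graph G"
  shows "\<exists>c. proper_coloring G (chromatic_number G) c"
proof -
  interpret graph G by fact
  obtain f :: "'a \<Rightarrow> nat" where f: "bij_betw f (verts G) {0..<card (verts G)}"
    using ex_bij_betw_finite_nat[OF finite_verts] by blast
  have "proper_coloring G (card (verts G)) f"
    unfolding proper_coloring_def
  proof (intro conjI allI impI)
    show "f \<in> verts G \<rightarrow> {..<card (verts G)}"
      using f by (auto simp: bij_betw_def)
    fix u v assume "u \<rightarrow>\<^bsub>G\<^esub> v"
    then show "f u \<noteq> f v"
      using f adj_in_verts adj_not_same by (metis bij_betw_def inj_onD)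
  qed
  then have "\<exists>k c. proper_coloring G k c"
    by blast
  then show ?thesis
    unfolding chromatic_number_def by (rule LeastI_ex)
qed

end

theory Submission
  imports Defs
begin

text \<open>
  The proof gives \<open>\<chi> \<le> \<omega>\<^sup>3\<close>, by induction along the modular decomposition; only the case
  where \<open>G\<close> and its complement are connected is not immediate. Then the maximal proper modules
  partition \<open>G\<close>. Let \<open>X\<close> be one with largest clique number \<open>m\<close>. Its complete neighbourhood has
  clique number at most \<open>\<omega> - m\<close> and takes \<open>(\<omega> - m)\<^sup>3\<close> colours, so it is enough to colour the
  anticomplete part \<open>M\<close> with \<open>m * \<omega>\<^sup>2\<close> colours.

  Fix \<open>v \<in> X\<close>. A module \<open>Y\<close> of \<open>M\<close> that is not contained in a block of \<open>G\<close> is split by a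
  neighbour \<open>y\<close> of \<open>v\<close>. As \<open>v\<close> is a pendant vertex at \<open>y\<close>, bull-freeness makes every component
  of \<open>N(y) \<inter> Y\<close> a module of \<open>Y\<close>; hence in the prime quotient \<open>Q\<close> of \<open>Y\<close> the neighbours of \<open>y\<close>
  form a stable set \<open>S \<noteq> {}\<close>. Any module \<open>X'\<close> of \<open>Q - S\<close> with two vertices is split by some
  \<open>s \<in> S\<close>. The bull with pendant edge \<open>s y\<close> and the \<open>P\<^sub>6\<close> starting with \<open>v, y, s\<close> show that the
  components of \<open>N(s) \<inter> X'\<close> and of \<open>X' - N(s)\<close> are modules, so \<open>X'\<close> is a substitution into a
  bipartite graph.

  Give \<open>q \<in> Q\<close> the clique number \<open>w q\<close> of its block as weight, and let \<open>N\<close> be the weighted clique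
  number. Each \<open>s \<in> S\<close> receives the colours below \<open>(w s)\<^sup>2\<close>, while the bipartite structure allows
  every \<open>z \<in> Q - S\<close> to receive \<open>(w z)\<^sup>2\<close> colours out of \<open>[(N - w z)\<^sup>2, N\<^sup>2)\<close>. These are disjoint for
  adjacent \<open>s\<close> and \<open>z\<close> because \<open>w s + w z \<le> N\<close>.
\<close>

section \<open>Graphs as symmetric irreflexive relations\<close>

locale simple_relation =
  fixes E :: "'a \<Rightarrow> 'a \<Rightarrow> bool"
  assumes sym: "E x y \<Longrightarrow> E y x"
    and irrefl: "\<not> E x x"
begin

lemma sym_iff: "E x y \<longleftrightarrow> E y x"
  using sym by blast

definition clique :: "'a set \<Rightarrow> bool" where
  "clique K \<longleftrightarrow> (\<forall>x\<in>K. \<forall>y\<in>K. x \<noteq> y \<longrightarrow> E x y)"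

definition clique_weight :: "('a \<Rightarrow> nat) \<Rightarrow> 'a set \<Rightarrow> nat" where
  "clique_weight w A = Max (sum w ` {K. K \<subseteq> A \<and> clique K})"

abbreviation omega :: "'a set \<Rightarrow> nat" where
  "omega \<equiv> clique_weight (\<lambda>_. 1)"

definition colorable :: "'a set \<Rightarrow> nat \<Rightarrow> bool" where
  "colorable A k \<longleftrightarrow> (\<exists>c :: 'a \<Rightarrow> nat. (\<forall>x\<in>A. c x < k) \<and> (\<forall>x\<in>A. \<forall>y\<in>A. E x y \<longrightarrow> c x \<noteq> c y))"

text \<open>A vertex of a quotient stands for a whole block and therefore receives a set of colours.
  The sizes of these sets vary with the vertex and are prescribed separately.\<close>

definition set_coloring :: "'a set \<Rightarrow> ('a \<Rightarrow> nat set) \<Rightarrow> bool" where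
  "set_coloring A f \<longleftrightarrow> (\<forall>x\<in>A. \<forall>y\<in>A. E x y \<longrightarrow> f x \<inter> f y = {})"

definition module :: "'a set \<Rightarrow> 'a set \<Rightarrow> bool" where
  "module A X \<longleftrightarrow> X \<subseteq> A \<and> (\<forall>z\<in>A - X. \<forall>x\<in>X. \<forall>y\<in>X. E z x \<longleftrightarrow> E z y)"

text \<open>For \<open>e = False\<close> the graph on \<open>A\<close> is disconnected, for
  \<open>e = True\<close> its complement is.\<close>

definition decomposable :: "'a set \<Rightarrow> bool" where
  "decomposable A \<longleftrightarrow> (\<exists>B C e. A = B \<union> C \<and> B \<inter> C = {} \<and> B \<noteq> {} \<and> C \<noteq> {} \<and>
     (\<forall>b\<in>B. \<forall>c\<in>C. E b c \<longleftrightarrow> e))"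

text \<open>For a finite indecomposable \<open>A\<close> with at least two elements this is the maximal proper
  module containing \<open>x\<close>.\<close>

definition block :: "'a set \<Rightarrow> 'a \<Rightarrow> 'a set" where
  "block A x = \<Union>{X. module A X \<and> X \<noteq> A \<and> x \<in> X}"

section \<open>Weighted clique numbers\<close>

lemma clique_weight_attained:
  assumes "finite A"
  obtains K where "K \<subseteq> A" "clique K" "sum w K = clique_weight w A"
proof -
  have "finite (sum w ` {K. K \<subseteq> A \<and> clique K})"
    using assms by (intro finite_imageI) (auto intro: finite_subset[of _ "Pow A"])
  moreover have "{} \<in> {K. K \<subseteq> A \<and> clique K}"
    by (simp add: clique_def)
  ultimately have "clique_weight w A \<in> sum w ` {K. K \<subseteq> A \<and> clique K}"
    unfolding clique_weight_def by (intro Max_in) auto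
  then show thesis
    using that by auto
qed

lemma clique_weight_ge:
  assumes "finite A" "K \<subseteq> A" "clique K"
  shows "sum w K \<le> clique_weight w A"
proof -
  have "finite (sum w ` {K. K \<subseteq> A \<and> clique K})"
    using assms by (intro finite_imageI) (auto intro: finite_subset[of _ "Pow A"])
  then show ?thesis
    unfolding clique_weight_def using assms by (intro Max_ge) auto
qed

lemma clique_weight_mono:
  assumes "finite B" "A \<subseteq> B"
  shows "clique_weight w A \<le> clique_weight w B"
  by (metis assms clique_weight_attained clique_weight_ge finite_subset subset_trans)

lemma clique_weight_elem:
  assumes "finite A" "x \<in> A"
  shows "w x \<le> clique_weight w A"
  using clique_weight_ge[of A "{x}" w] assms by (simp add: clique_def)

text \<open>Optimal cliques of the two sides unite to a clique. A common vertex of \<open>A\<close>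
  and \<open>B\<close> would be adjacent to itself, so the weights add up.\<close>

lemma clique_weight_join:
  assumes "finite A" "finite B" and AB: "\<And>a b. a \<in> A \<Longrightarrow> b \<in> B \<Longrightarrow> E a b"
    and sub: "A \<subseteq> X" "B \<subseteq> X" "finite X"
  shows "clique_weight w A + clique_weight w B \<le> clique_weight w X"
proof -
  obtain K where K: "K \<subseteq> A" "clique K" "sum w K = clique_weight w A"
    using clique_weight_attained[OF assms(1)] by blast
  obtain L where L: "L \<subseteq> B" "clique L" "sum w L = clique_weight w B"
    using clique_weight_attained[OF assms(2)] by blast
  have "A \<inter> B = {}"
    using AB irrefl by blast
  then have "sum w (K \<union> L) = clique_weight w A + clique_weight w B"
    using K L assms(1,2) by (subst sum.union_disjoint) (auto intro: finite_subset)
  moreover have "clique (K \<union> L)"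
    using K L AB sym unfolding clique_def by blast
  ultimately show ?thesis
    using clique_weight_ge[of X "K \<union> L" w] K L sub by fastforce
qed

text \<open>Replacing each vertex \<open>q\<close> of an optimal weighted clique by a maximum clique
  of \<open>B q\<close> yields a clique of \<open>Y\<close>. This allows the clique numbers of
  blocks to serve as weights in the quotient.\<close>

lemma clique_weight_substitution:
  assumes "finite Q" "finite Y" and BY: "\<And>q. q \<in> Q \<Longrightarrow> B q \<subseteq> Y"
    and BB: "\<And>p q x y. \<lbrakk>p \<in> Q; q \<in> Q; E p q; x \<in> B p; y \<in> B q\<rbrakk> \<Longrightarrow> E x y"
  shows "clique_weight (\<lambda>q. omega (B q)) Q \<le> omega Y"
proof -
  obtain K where K: "K \<subseteq> Q" "clique K"
      "sum (\<lambda>q. omega (B q)) K = clique_weight (\<lambda>q. omega (B q)) Q"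
    using clique_weight_attained[OF assms(1)] by blast
  have "\<exists>L. L \<subseteq> B q \<and> clique L \<and> card L = omega (B q)" if "q \<in> Q" for q
    using clique_weight_attained[of "B q" "\<lambda>_. 1"] finite_subset[OF BY[OF that] assms(2)]
    by (metis card_eq_sum)
  then obtain L where L: "\<And>q. q \<in> Q \<Longrightarrow> L q \<subseteq> B q \<and> clique (L q) \<and> card (L q) = omega (B q)"
    by metis
  have finL: "finite (L q)" if "q \<in> Q" for q
    using L[OF that] BY[OF that] assms(2) by (meson finite_subset subset_trans)
  have cross: "E x y" if "p \<in> K" "q \<in> K" "p \<noteq> q" "x \<in> L p" "y \<in> L q" for p q x y
  proof -
    have "E p q"
      using K(2) that unfolding clique_def by blast
    then show ?thesis
      using BB[of p q x y] L K(1) that by blast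
  qed
  have "card (\<Union>q\<in>K. L q) = (\<Sum>q\<in>K. card (L q))"
  proof (rule card_UN_disjoint)
    show "finite K"
      using K(1) assms(1) finite_subset by blast
    show "\<forall>q\<in>K. finite (L q)"
      using finL K(1) by blast
    show "\<forall>p\<in>K. \<forall>q\<in>K. p \<noteq> q \<longrightarrow> L p \<inter> L q = {}"
      using cross irrefl by blast
  qed
  also have "\<dots> = clique_weight (\<lambda>q. omega (B q)) Q"
    using K L by (metis (no_types, lifting) subsetD sum.cong)
  finally have card: "card (\<Union>q\<in>K. L q) = clique_weight (\<lambda>q. omega (B q)) Q" .
  have "clique (\<Union>q\<in>K. L q)"
    unfolding clique_def
  proof (intro ballI impI)
    fix x y assume "x \<in> (\<Union>q\<in>K. L q)" "y \<in> (\<Union>q\<in>K. L q)" "x \<noteq> y"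
    then obtain p q where pq: "p \<in> K" "q \<in> K" "x \<in> L p" "y \<in> L q"
      by blast
    show "E x y"
    proof (cases "p = q")
      case True
      then show ?thesis
        using L[of p] K(1) pq \<open>x \<noteq> y\<close> unfolding clique_def by blast
    next
      case False
      then show ?thesis
        using cross pq by blast
    qed
  qed
  moreover have "(\<Union>q\<in>K. L q) \<subseteq> Y"
    using K(1) L BY by blast
  ultimately show ?thesis
    using clique_weight_ge[OF assms(2), of "\<Union>q\<in>K. L q" "\<lambda>_. 1"] card by simp
qed

section \<open>Combining colourings\<close>

lemma colorable_mono: "colorable A k \<Longrightarrow> k \<le> l \<Longrightarrow> B \<subseteq> A \<Longrightarrow> colorable B l"
  unfolding colorable_def by (elim exE, rule exI) (auto intro: order_less_le_trans)

lemma colorable_anticomplete_union: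
  assumes "colorable A k" "colorable B k" and AB: "\<And>a b. a \<in> A \<Longrightarrow> b \<in> B \<Longrightarrow> \<not> E a b"
  shows "colorable (A \<union> B) k"
proof -
  obtain c d :: "'a \<Rightarrow> nat" where c: "\<And>x. x \<in> A \<Longrightarrow> c x < k"
      "\<And>x y. x \<in> A \<Longrightarrow> y \<in> A \<Longrightarrow> E x y \<Longrightarrow> c x \<noteq> c y"
    and d: "\<And>x. x \<in> B \<Longrightarrow> d x < k"
      "\<And>x y. x \<in> B \<Longrightarrow> y \<in> B \<Longrightarrow> E x y \<Longrightarrow> d x \<noteq> d y"
    using assms(1,2) unfolding colorable_def by blast
  define e where "e x = (if x \<in> A then c x else d x)" for x
  have "e x < k" if "x \<in> A \<union> B" for x
    using c d that by (auto simp: e_def)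
  moreover have "e x \<noteq> e y" if "x \<in> A \<union> B" "y \<in> A \<union> B" "E x y" for x y
    using c(2)[of x y] d(2)[of x y] AB[of x y] AB[of y x] that sym[of x y]
    by (cases "x \<in> A"; cases "y \<in> A") (simp_all add: e_def)
  ultimately show ?thesis
    unfolding colorable_def by (intro exI[of _ e]) simp
qed

lemma colorable_union:
  assumes "colorable A k" "colorable B l"
  shows "colorable (A \<union> B) (k + l)"
proof -
  obtain c d :: "'a \<Rightarrow> nat" where c: "\<And>x. x \<in> A \<Longrightarrow> c x < k"
      "\<And>x y. x \<in> A \<Longrightarrow> y \<in> A \<Longrightarrow> E x y \<Longrightarrow> c x \<noteq> c y"
    and d: "\<And>x. x \<in> B \<Longrightarrow> d x < l"
      "\<And>x y. x \<in> B \<Longrightarrow> y \<in> B \<Longrightarrow> E x y \<Longrightarrow> d x \<noteq> d y"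
    using assms unfolding colorable_def by blast
  define e where "e x = (if x \<in> A then c x else k + d x)" for x
  have "e x < k + l" if "x \<in> A \<union> B" for x
    using c(1)[of x] d(1)[of x] that by (cases "x \<in> A") (simp_all add: e_def)
  moreover have "e x \<noteq> e y" if "x \<in> A \<union> B" "y \<in> A \<union> B" "E x y" for x y
    using c(1)[of x] c(1)[of y] c(2)[of x y] d(2)[of x y] that
    by (cases "x \<in> A"; cases "y \<in> A") (simp_all add: e_def)
  ultimately show ?thesis
    unfolding colorable_def by (intro exI[of _ e]) simp
qed

text \<open>A colour of the fibre over \<open>q\<close> is split by division by \<open>m\<close>:
  the quotient selects an element of \<open>f q\<close>, the remainder is kept. Adjacent vertices of
  different fibres then differ in the selected element, and within one fibre the pair determines the
  original colour.\<close>

lemma colorable_substitution: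
  assumes r: "\<And>x. x \<in> Y \<Longrightarrow> r x \<in> Q"
    and hom: "\<And>x y. x \<in> Y \<Longrightarrow> y \<in> Y \<Longrightarrow> E x y \<Longrightarrow> r x \<noteq> r y \<Longrightarrow> E (r x) (r y)"
    and fib: "\<And>q. q \<in> Q \<Longrightarrow> colorable {x \<in> Y. r x = q} (card (f q) * m)"
    and f: "set_coloring Q f" and fN: "\<And>q. q \<in> Q \<Longrightarrow> f q \<subseteq> {..<N}"
  shows "colorable Y (N * m)"
proof -
  have "\<exists>h. bij_betw h {0..<card (f q)} (f q)" if "q \<in> Q" for q
    using ex_bij_betw_nat_finite[of "f q"] finite_subset[OF fN[OF that]] by simp
  then obtain h where h: "\<And>q. q \<in> Q \<Longrightarrow> bij_betw (h q) {0..<card (f q)} (f q)"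
    by metis
  have "\<forall>q. \<exists>c :: 'a \<Rightarrow> nat. q \<in> Q \<longrightarrow> (\<forall>x\<in>{x \<in> Y. r x = q}. c x < card (f q) * m) \<and>
      (\<forall>x\<in>{x \<in> Y. r x = q}. \<forall>y\<in>{x \<in> Y. r x = q}. E x y \<longrightarrow> c x \<noteq> c y)"
    using fib unfolding colorable_def by blast
  from choice[OF this] obtain c :: "'a \<Rightarrow> 'a \<Rightarrow> nat"
    where c: "\<forall>q. q \<in> Q \<longrightarrow> (\<forall>x\<in>{x \<in> Y. r x = q}. c q x < card (f q) * m) \<and>
      (\<forall>x\<in>{x \<in> Y. r x = q}. \<forall>y\<in>{x \<in> Y. r x = q}. E x y \<longrightarrow> c q x \<noteq> c q y)"
    by (elim exE)
  have c1: "c (r x) x < card (f (r x)) * m" if "x \<in> Y" for x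
    using c r that by blast
  have c2: "c (r x) x \<noteq> c (r x) y" if "x \<in> Y" "y \<in> Y" "r x = r y" "E x y" for x y
    using c[rule_format, OF r[OF that(1)]] that by simp
  define g where "g x = h (r x) (c (r x) x div m)" for x
  define k where "k x = g x * m + c (r x) x mod m" for x
  have dv: "c (r x) x div m < card (f (r x))" and m: "m > 0" if "x \<in> Y" for x
    using c1[OF that] by (auto simp: less_mult_imp_div_less intro!: gr0I)
  have g: "g x \<in> f (r x)" if "x \<in> Y" for x
    using h[OF r[OF that]] dv[OF that] unfolding g_def bij_betw_def by auto
  have kdiv: "k x div m = g x" "k x mod m = c (r x) x mod m" if "x \<in> Y" for x
    using m[OF that] by (auto simp: k_def)
  have "k x < N * m" if "x \<in> Y" for x
  proof -
    have "g x < N"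
      using g[OF that] fN[OF r[OF that]] by auto
    then have "Suc (g x) * m \<le> N * m"
      by (intro mult_right_mono) auto
    moreover have "k x < Suc (g x) * m"
      using m[OF that] by (simp add: k_def)
    ultimately show ?thesis
      by linarith
  qed
  moreover have "k x \<noteq> k y" if xy: "x \<in> Y" "y \<in> Y" "E x y" for x y
  proof
    assume eq: "k x = k y"
    then have geq: "g x = g y" and modeq: "c (r x) x mod m = c (r y) y mod m"
      using kdiv xy by metis+
    have ryx: "r x = r y"
    proof (rule ccontr)
      assume "r x \<noteq> r y"
      then have "f (r x) \<inter> f (r y) = {}"
        using f hom r xy unfolding set_coloring_def by blast
      then show False
        using g xy geq by fastforce
    qed
    then have "c (r x) x div m = c (r x) y div m"
      using geq h[OF r[OF xy(1)]] dv xy unfolding g_def bij_betw_def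
      by (metis atLeastLessThan_iff inj_onD le0)
    then have "c (r x) x = c (r x) y"
      using modeq ryx by (metis div_mult_mod_eq)
    then show False
      using c2 xy ryx by blast
  qed
  ultimately show ?thesis
    unfolding colorable_def by (intro exI[of _ k]) simp
qed

section \<open>Modules and maximal proper modules\<close>

lemma module_trans:
  assumes "module A B" "module B C"
  shows "module A C"
proof -
  have "E z x \<longleftrightarrow> E z y" if "z \<in> A - C" "x \<in> C" "y \<in> C" for x y z
    using assms that unfolding module_def by (cases "z \<in> B") blast+
  then show ?thesis
    using assms unfolding module_def by blast
qed

text \<open>Lets an induction over the modules of \<open>A\<close> continue with both parts of a
  decomposable module.\<close>

lemma module_const_part:
  assumes "module A (B \<union> C)" "B \<inter> C = {}" "\<And>b c. b \<in> B \<Longrightarrow> c \<in> C \<Longrightarrow> E b c \<longleftrightarrow> e"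
  shows "module A B" "module A C"
  using assms sym_iff unfolding module_def by (blast, blast)

lemma module_Un:
  assumes "module A X" "module A Z" "x \<in> X" "x \<in> Z"
  shows "module A (X \<union> Z)"
  using assms unfolding module_def by blast

text \<open>Two overlapping modules that cover \<open>A\<close> split it into \<open>X - Z\<close> and \<open>Z\<close>.\<close>

lemma module_Un_proper:
  assumes "\<not> decomposable A" "module A X" "module A Z" "x \<in> X" "x \<in> Z" "X \<noteq> A" "Z \<noteq> A"
  shows "X \<union> Z \<noteq> A"
proof
  assume A: "X \<union> Z = A"
  have "\<exists>b0. b0 \<in> Z - X"
    using A assms unfolding module_def by blast
  then obtain b0 where b0: "b0 \<in> Z" "b0 \<notin> X"
    by blast
  have "E a b \<longleftrightarrow> E b0 x" if a: "a \<in> X - Z" and b: "b \<in> Z" for a b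
  proof -
    have "E a b \<longleftrightarrow> E a b0"
      using assms(2,3) A a b b0 unfolding module_def by blast
    also have "\<dots> \<longleftrightarrow> E b0 a"
      by (rule sym_iff)
    also have "\<dots> \<longleftrightarrow> E b0 x"
      using assms(2,4) A a b0 unfolding module_def by blast
    finally show ?thesis .
  qed
  moreover have "A = (X - Z) \<union> Z" "(X - Z) \<inter> Z = {}" "X - Z \<noteq> {}" "Z \<noteq> {}"
    using A assms unfolding module_def by auto
  ultimately have "decomposable A"
    unfolding decomposable_def by blast
  then show False
    using assms(1) by blast
qed

text \<open>The proper modules containing \<open>x\<close> are closed under union, so a maximal one
  contains all others and equals their union. The condition \<open>A \<noteq> {x}\<close> makes
  \<open>{x}\<close> a proper module, so that there is at least one.\<close>

lemma
  assumes "finite A" "\<not> decomposable A" "x \<in> A" "A \<noteq> {x}"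
  shows self_in_block: "x \<in> block A x"
    and module_block: "module A (block A x)"
    and block_proper: "block A x \<noteq> A"
proof -
  define F where "F = {X. module A X \<and> X \<noteq> A \<and> x \<in> X}"
  have "{x} \<in> F"
    using assms by (auto simp: F_def module_def)
  moreover have "finite F"
    by (rule finite_subset[of _ "Pow A"]) (auto simp: F_def module_def assms)
  ultimately obtain X where X: "X \<in> F" "\<And>Z. Z \<in> F \<Longrightarrow> X \<subseteq> Z \<Longrightarrow> X = Z"
    using finite_has_maximal[of F] by blast
  have "Z \<subseteq> X" if "Z \<in> F" for Z
  proof -
    have "X \<union> Z \<in> F"
      using X(1) that module_Un[of A X Z x] module_Un_proper[of A X Z x] assms
      by (auto simp: F_def)
    then show ?thesis
      using X(2) by blast
  qed
  then have "block A x = X"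
    using X(1) unfolding block_def F_def[symmetric] by blast
  then show "x \<in> block A x" "module A (block A x)" "block A x \<noteq> A"
    using X(1) by (auto simp: F_def)
qed

lemma module_subset_block: "module A Z \<Longrightarrow> Z \<noteq> A \<Longrightarrow> x \<in> Z \<Longrightarrow> Z \<subseteq> block A x"
  unfolding block_def by blast

text \<open>The block of \<open>x\<close> is a proper module containing \<open>y\<close>, hence lies
  in the block of \<open>y\<close>; this puts \<open>x\<close> into the latter, and the argument can
  be reversed. So the blocks partition \<open>A\<close>.\<close>

lemma block_eq:
  assumes "finite A" "\<not> decomposable A" "x \<in> A" "A \<noteq> {x}" "y \<in> block A x"
  shows "block A y = block A x"
proof -
  note x = self_in_block[OF assms(1-4)] module_block[OF assms(1-4)] block_proper[OF assms(1-4)]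
  have y: "y \<in> A" "A \<noteq> {y}"
    using x assms(3-5) unfolding module_def by auto
  have "block A x \<subseteq> block A y"
    using module_subset_block x assms(5) by blast
  moreover have "block A y \<subseteq> block A x"
    using module_subset_block[OF module_block block_proper] assms(1,2) y x(1) calculation by blast
  ultimately show ?thesis
    by blast
qed

end

section \<open>Set colourings of substitutions into bipartite graphs\<close>

text \<open>Spreading out the residues modulo \<open>a\<close> into a window of the residues modulo \<open>a + k\<close> maps the
  colours below \<open>a\<^sup>2 - (a - w)\<^sup>2\<close> to colours below \<open>(a + k)\<^sup>2 - (a + k - w)\<^sup>2\<close>.\<close>

lemma residue_shift_less:
  fixes a k n w :: nat
  assumes "1 \<le> a" "w \<le> a" "n < w * (2 * a - w)"
  shows "(n div a) * (a + k) + k + n mod a < w * (2 * (a + k) - w)"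
proof -
  define q where "q = n div a"
  have n: "q * a + n mod a = n"
    unfolding q_def by simp
  \<comment> \<open>The shift adds \<open>(q + 1) * k\<close> to the colour \<open>n\<close>, while
    the bound grows by \<open>2 * w * k\<close>. So it is enough that
    \<open>q < 2 * w\<close>.\<close>
  have "q * a < 2 * w * a"
  proof -
    have "q * a \<le> n"
      using n by linarith
    also have "n < w * (2 * a - w)"
      by fact
    also have "\<dots> \<le> w * (2 * a)"
      by (intro mult_left_mono) auto
    finally show ?thesis
      by (simp only: mult_ac)
  qed
  then have "q + 1 \<le> 2 * w"
    by simp
  then have "(q + 1) * k \<le> 2 * w * k"
    by (rule mult_right_mono) simp
  moreover have "w * (2 * (a + k) - w) = w * (2 * a - w) + 2 * w * k"
    using assms(2) by (simp add: algebra_simps diff_mult_distrib2)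
  moreover have "q * (a + k) + k + n mod a = n + (q + 1) * k"
    using n by (simp add: algebra_simps)
  ultimately show ?thesis
    unfolding q_def[symmetric] using assms(3) by linarith
qed

text \<open>The adjacencies and non-adjacencies below force the vertices to be distinct.\<close>

locale bull_P6_free = simple_relation +
  assumes bull_free: "\<lbrakk>E a b; E b c; E a c; E a d; E b e;
      \<not> E c d; \<not> E c e; \<not> E d e; \<not> E a e; \<not> E b d\<rbrakk> \<Longrightarrow> False"
    and P6_free: "\<lbrakk>E p1 p2; E p2 p3; E p3 p4; E p4 p5; E p5 p6;
      \<not> E p1 p3; \<not> E p1 p4; \<not> E p1 p5; \<not> E p1 p6; \<not> E p2 p4; \<not> E p2 p5; \<not> E p2 p6;
      \<not> E p3 p5; \<not> E p3 p6; \<not> E p4 p6\<rbrakk> \<Longrightarrow> False"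
begin

text \<open>If \<open>s\<close> splits \<open>X\<close>, then the classes of \<open>T\<^sup>*\<close> are the components of \<open>N(s) \<inter> X\<close> and of
  \<open>X - N(s)\<close>. A class of weight \<open>a\<close> uses the lowest \<open>a\<close> residues modulo \<open>N\<close> on the side of \<open>N(s)\<close>
  and the highest \<open>a\<close> residues on the other side. Note that
  \<open>w z * (2 * N - w z) = N\<^sup>2 - (N - w z)\<^sup>2\<close>.\<close>

lemma module_set_coloring:
  assumes fin: "finite P" and w: "\<And>p. p \<in> P \<Longrightarrow> 1 \<le> w p"
    and vy: "E v y" and far: "\<And>p. p \<in> P \<Longrightarrow> \<not> E v p \<and> \<not> E y p"
    and splits: "\<And>X. module P X \<Longrightarrow> 2 \<le> card X \<Longrightarrow>
      \<exists>s. E y s \<and> \<not> E v s \<and> (\<exists>a\<in>X. E s a) \<and> (\<exists>b\<in>X. \<not> E s b)"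
    and "module P X" "clique_weight w X \<le> N"
  shows "\<exists>f. set_coloring X f \<and> (\<forall>z\<in>X. f z \<subseteq> {..<w z * (2 * N - w z)} \<and> card (f z) = (w z)\<^sup>2)"
  using assms(6,7)
proof (induction "card X" arbitrary: X N rule: less_induct)
  case less
  have XP: "X \<subseteq> P" and finX: "finite X"
    using less.prems(1) fin unfolding module_def by (auto intro: finite_subset)
  show ?case
  proof (cases "2 \<le> card X")
    case False
    then have "card X = 0 \<or> card X = 1"
      by linarith
    then have single: "x = z" if "x \<in> X" "z \<in> X" for x z
      using that finX by (auto simp: card_1_singleton_iff)
    have "{..<(w z)\<^sup>2} \<subseteq> {..<w z * (2 * N - w z)}" if "z \<in> X" for z
    proof -
      have "w z \<le> N"
        using clique_weight_elem[of X z w] finX that less.prems(2) by simp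
      then have "w z * w z \<le> w z * (2 * N - w z)"
        by (intro mult_left_mono) auto
      then show ?thesis
        by (auto simp: power2_eq_square)
    qed
    then show ?thesis
      using single irrefl by (intro exI[of _ "\<lambda>z. {..<(w z)\<^sup>2}"]) (auto simp: set_coloring_def)
  next
    case True
    then obtain s where s: "E y s" "\<not> E v s" "\<exists>a\<in>X. E s a" "\<exists>b\<in>X. \<not> E s b"
      using splits less.prems(1) by blast
    define T where "T = {(p, q). p \<in> X \<and> q \<in> X \<and> E p q \<and> (E s p \<longleftrightarrow> E s q)}"
    define C where "C x = {z. (x, z) \<in> T\<^sup>*}" for x
    have symT: "sym (T\<^sup>*)"
      by (intro sym_rtrancl symI) (auto simp: T_def sym)
    have C_refl: "x \<in> C x" for x
      by (simp add: C_def)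
    have C_side: "z \<in> X \<and> (E s z \<longleftrightarrow> E s x)" if "z \<in> C x" "x \<in> X" for x z
    proof -
      have "(x, z) \<in> T\<^sup>*"
        using that by (simp add: C_def)
      then show ?thesis
        using that(2) by (induction rule: rtrancl_induct) (auto simp: T_def)
    qed
    have C_eq: "C z = C x" if "z \<in> C x" for x z
      using that symT unfolding C_def by (auto dest: symD intro: rtrancl_trans)
    have C_edge: "C x = C z" if "x \<in> X" "z \<in> X" "E x z" "E s x \<longleftrightarrow> E s z" for x z
      using that by (intro C_eq) (auto simp: C_def T_def sym)
    \<comment> \<open>If \<open>s\<close> is adjacent to \<open>p\<close> and \<open>q\<close>, the
      bull is the triangle \<open>s, p, q\<close> with pendant vertices \<open>y\<close> at
      \<open>s\<close> and \<open>d\<close> at \<open>p\<close>. Otherwise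
      \<open>v, y, s, d, p, q\<close> is an induced path.\<close>
    have edge_transfer: "E d q" if "(p, q) \<in> T" "d \<in> X" "E s d \<noteq> E s p" "E d p" for d p q
    proof (rule ccontr)
      assume "\<not> E d q"
      have pq: "p \<in> P" "q \<in> P" "d \<in> P" "E p q" "E s p \<longleftrightarrow> E s q"
        using that XP by (auto simp: T_def)
      show False
      proof (cases "E s p")
        case True
        then show False
          using bull_free[of s p q y d] far pq s that \<open>\<not> E d q\<close> sym by blast
      next
        case False
        then show False
          using P6_free[of v y s d p q] vy far pq s that \<open>\<not> E d q\<close> by blast
      qed
    qed
    have uniform: "E d z \<longleftrightarrow> E d x" if "x \<in> X" "d \<in> X" "E s d \<noteq> E s x" "z \<in> C x" for d x z
    proof -
      have "(x, z) \<in> T\<^sup>*"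
        using that by (simp add: C_def)
      then show ?thesis
      proof (induction rule: rtrancl_induct)
        case (step p q)
        have "p \<in> C x" "q \<in> C x"
          using step.hyps by (auto simp: C_def intro: rtrancl_into_rtrancl)
        moreover have "(q, p) \<in> T"
          using step.hyps(2) by (auto simp: T_def sym)
        ultimately have "E s d \<noteq> E s p" "E s d \<noteq> E s q"
          using C_side that by blast+
        then show ?case
          using step.IH \<open>(q, p) \<in> T\<close> step.hyps(2) that(2) edge_transfer by blast
      qed simp
    qed
    \<comment> \<open>Vertices outside \<open>X\<close> do not split \<open>X\<close>, those of
      \<open>X\<close> on the other side of \<open>s\<close> are handled by \<open>uniform\<close>,
      and those on the same side lie in another component and have no neighbour in
      \<open>C x\<close>.\<close>
    have modC: "module P (C x)" if "x \<in> X" for x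
    proof -
      have "E z p \<longleftrightarrow> E z q" if z: "z \<in> P - C x" and p: "p \<in> C x" and q: "q \<in> C x" for z p q
      proof (cases "z \<in> X")
        case False
        then show ?thesis
          using less.prems(1) z C_side[OF p \<open>x \<in> X\<close>] C_side[OF q \<open>x \<in> X\<close>]
          unfolding module_def by blast
      next
        case True
        show ?thesis
        proof (cases "E s z \<longleftrightarrow> E s x")
          case False
          then show ?thesis
            using uniform \<open>x \<in> X\<close> True p q by blast
        next
          case side: True
          have "\<not> E z u" if "u \<in> C x" for u
            using C_edge[of u z] C_eq[OF that] C_refl[of z] C_side[OF that \<open>x \<in> X\<close>] z True side sym
            by blast
          then show ?thesis
            using p q by blast
        qed
      qed
      then show ?thesis
        using C_side XP that unfolding module_def by blast
    qed
    define a where "a x = clique_weight w (C x)" for x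
    have finC: "finite (C x)" if "x \<in> X" for x
      using C_side[OF _ that] finX by (auto intro: finite_subset)
    have "\<exists>f. set_coloring W f \<and>
        (\<forall>z\<in>W. f z \<subseteq> {..<w z * (2 * clique_weight w W - w z)} \<and> card (f z) = (w z)\<^sup>2)"
      if "x \<in> X" "W = C x" for x W
    proof -
      have "C x \<noteq> X" "C x \<subseteq> X"
        using s(3,4) C_side[OF _ that(1)] by blast+
      then have "card (C x) < card X"
        using finX by (intro psubset_card_mono) auto
      then show ?thesis
        using less.hyps[of "C x"] modC that by blast
    qed
    \<comment> \<open>The choice is indexed by the class instead of a vertex in it, so that all
      vertices of a class use the same colouring.\<close>
    then have "\<forall>W. \<exists>f. (\<exists>x\<in>X. W = C x) \<longrightarrow> set_coloring W f \<and>
        (\<forall>z\<in>W. f z \<subseteq> {..<w z * (2 * clique_weight w W - w z)} \<and> card (f z) = (w z)\<^sup>2)"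
      by blast
    from choice[OF this] obtain F where F': "\<forall>W. (\<exists>x\<in>X. W = C x) \<longrightarrow> set_coloring W (F W) \<and>
        (\<forall>z\<in>W. F W z \<subseteq> {..<w z * (2 * clique_weight w W - w z)} \<and> card (F W z) = (w z)\<^sup>2)"
      by (elim exE)
    have F: "set_coloring (C x) (F (C x))" "F (C x) x \<subseteq> {..<w x * (2 * a x - w x)}"
      "card (F (C x) x) = (w x)\<^sup>2" if "x \<in> X" for x
      using F' that C_refl unfolding a_def by blast+
    have wa: "1 \<le> a x" "w x \<le> a x" "a x \<le> N" if "x \<in> X" for x
    proof -
      show "w x \<le> a x"
        unfolding a_def using clique_weight_elem finC C_refl that by blast
      then show "1 \<le> a x"
        using w[of x] XP that by (meson le_trans subsetD)
      have "C x \<subseteq> X"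
        using C_side that by blast
      then show "a x \<le> N"
        unfolding a_def using clique_weight_mono[OF finX] less.prems(2) le_trans by blast
    qed
    define offset where "offset x = (if E s x then 0 else N - a x)" for x
    \<comment> \<open>The quotient by \<open>a x\<close> becomes the quotient by \<open>N\<close>,
      and the remainder moves into the window of residues that starts at \<open>offset x\<close>.
      Both can be read off again, so \<open>g x\<close> is injective.\<close>
    define g where "g x n = (n div a x) * N + (offset x + n mod a x)" for x n
    have offset: "offset x + n mod a x < N" if "x \<in> X" for x n
    proof -
      have "n mod a x < a x"
        using wa that by (intro mod_less_divisor) fastforce
      then show ?thesis
        using wa(3)[OF that] unfolding offset_def by (split if_split) linarith
    qed
    have gdm: "g x n div N = n div a x" "g x n mod N = offset x + n mod a x" if "x \<in> X" for x n
      using offset[OF that, of n] by (auto simp: g_def)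
    have g_inj: "n = n'" if "x \<in> X" "g x n = g x n'" for x n n'
      using gdm[OF that(1), of n] gdm[OF that(1), of n'] that(2)
      by (metis add_left_cancel div_mult_mod_eq)
    have g_less: "g x n < w x * (2 * N - w x)" if "x \<in> X" "n < w x * (2 * a x - w x)" for x n
    proof -
      have eq: "a x + (N - a x) = N" and "offset x \<le> N - a x"
        using wa(3)[OF that(1)] by (auto simp: offset_def)
      moreover have "n div a x * N + (N - a x) + n mod a x < w x * (2 * N - w x)"
        using residue_shift_less[OF wa(1)[OF that(1)] wa(2)[OF that(1)] that(2), of "N - a x"]
        unfolding eq .
      ultimately show ?thesis
        unfolding g_def by linarith
    qed
    define f where "f x = g x ` F (C x) x" for x
    have "f x \<subseteq> {..<w x * (2 * N - w x)}" "card (f x) = (w x)\<^sup>2" if "x \<in> X" for x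
    proof -
      show "f x \<subseteq> {..<w x * (2 * N - w x)}"
        using F(2)[OF that] g_less[OF that] by (auto simp: f_def)
      have "inj_on (g x) (F (C x) x)"
        using g_inj[OF that] by (intro inj_onI)
      then show "card (f x) = (w x)\<^sup>2"
        using F(3)[OF that] by (simp add: f_def card_image)
    qed
    moreover have disj: "f x \<inter> f z = {}" if xz: "x \<in> X" "z \<in> X" "E x z" and sx: "E s x" for x z
    proof (cases "E s z")
      case True
      then have C: "C x = C z"
        using C_edge xz sx by blast
      then have "F (C x) x \<inter> F (C z) z = {}"
        using F(1)[OF xz(1)] xz(3) C_refl[of x] C_refl[of z] unfolding set_coloring_def by metis
      moreover have "g x = g z"
        using C sx True by (auto simp: g_def a_def offset_def)
      ultimately show ?thesis
        using g_inj[OF xz(1)] unfolding f_def by fastforce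
    next
      case False
      \<comment> \<open>One edge between classes on opposite sides of \<open>s\<close> makes them
        complete to each other. Hence \<open>a x + a z \<le> N\<close>, and the low window of
        \<open>x\<close> does not meet the high window of \<open>z\<close>.\<close>
      have "E p q" if p: "p \<in> C x" and q: "q \<in> C z" for p q
      proof -
        have "E z p"
          using uniform[of x z p] xz sx False p sym by blast
        then have "E p z" "E s p" "p \<in> X"
          using C_side[OF p] xz sx sym by auto
        then show ?thesis
          using uniform[of z p q] xz False q by blast
      qed
      then have "a x + a z \<le> clique_weight w X"
        unfolding a_def using finC xz C_side finX by (intro clique_weight_join) blast+
      then have "a x + a z \<le> N"
        using less.prems(2) by linarith
      have "g x n \<noteq> g z n'" for n n'
      proof
        assume "g x n = g z n'"
        then have "offset x + n mod a x = offset z + n' mod a z"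
          using gdm(2)[OF xz(1), of n] gdm(2)[OF xz(2), of n'] by simp
        moreover have "n mod a x < a x"
          using wa[OF xz(1)] by (intro mod_less_divisor) simp
        ultimately show False
          using \<open>a x + a z \<le> N\<close> sx False by (auto simp: offset_def)
      qed
      then show ?thesis
        unfolding f_def by blast
    qed
    have "set_coloring X f"
      unfolding set_coloring_def
    proof (intro ballI impI)
      fix x z assume xz: "x \<in> X" "z \<in> X" "E x z"
      consider "E s x" | "E s z" | "\<not> E s x" "\<not> E s z"
        by blast
      then show "f x \<inter> f z = {}"
      proof cases
        case 1
        then show ?thesis
          using disj xz by blast
      next
        case 2
        then show ?thesis
          using disj[of z x] xz sym by blast
      next
        case 3
        then have C: "C x = C z"
          using C_edge xz by blast
        then have "F (C x) x \<inter> F (C z) z = {}"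
          using F(1)[OF xz(1)] xz(3) C_refl[of x] C_refl[of z] unfolding set_coloring_def by metis
        moreover have "g x = g z"
          using C 3 by (auto simp: g_def a_def offset_def)
        ultimately show ?thesis
          using g_inj[OF xz(1)] unfolding f_def by fastforce
      qed
    qed
    then show ?thesis
      using calculation by blast
  qed
qed

section \<open>Set colourings of prime quotients\<close>

lemma prime_set_coloring:
  assumes fin: "finite Q" and w: "\<And>q. q \<in> Q \<Longrightarrow> 1 \<le> w q"
    and vy: "E v y" and far: "\<And>q. q \<in> Q \<Longrightarrow> \<not> E v q"
    and stable: "\<And>p q. \<lbrakk>p \<in> Q; q \<in> Q; E y p; E y q\<rbrakk> \<Longrightarrow> \<not> E p q"
    and ne: "\<exists>q\<in>Q. E y q"
    and prime: "\<And>X. module Q X \<Longrightarrow> 2 \<le> card X \<Longrightarrow> X = Q"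
    and N: "clique_weight w Q \<le> N"
  shows "\<exists>f. set_coloring Q f \<and> (\<forall>q\<in>Q. f q \<subseteq> {..<N\<^sup>2} \<and> card (f q) = (w q)\<^sup>2)"
proof -
  define P where "P = {q \<in> Q. \<not> E y q}"
  \<comment> \<open>\<open>X\<close> misses the neighbours of \<open>y\<close>, so it is not all of
    \<open>Q\<close> and by primality not a module of \<open>Q\<close>. As it is a module of
    \<open>P\<close>, the vertex of \<open>Q\<close> splitting it lies outside \<open>P\<close> and
    is thus a neighbour of \<open>y\<close>.\<close>
  have splits: "\<exists>s. E y s \<and> \<not> E v s \<and> (\<exists>a\<in>X. E s a) \<and> (\<exists>b\<in>X. \<not> E s b)"
    if X: "module P X" "2 \<le> card X" for X
  proof -
    have "X \<subseteq> P"
      using X(1) unfolding module_def by blast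
    then have "X \<noteq> Q" "X \<subseteq> Q"
      using ne by (auto simp: P_def)
    then have "\<not> module Q X"
      using prime X by blast
    then obtain s a b where s: "s \<in> Q - X" "a \<in> X" "b \<in> X" "E s a" "\<not> E s b"
      using \<open>X \<subseteq> Q\<close> unfolding module_def by blast
    moreover have "s \<notin> P"
      using X(1) s unfolding module_def by blast
    ultimately show ?thesis
      using far by (auto simp: P_def)
  qed
  have "\<exists>f. set_coloring P f \<and> (\<forall>z\<in>P. f z \<subseteq> {..<w z * (2 * N - w z)} \<and> card (f z) = (w z)\<^sup>2)"
  proof (rule module_set_coloring[OF _ _ vy _ splits])
    show "clique_weight w P \<le> N"
      using clique_weight_mono[OF fin, of P w] N by (auto simp: P_def)
  qed (use fin w far in \<open>auto simp: P_def module_def\<close>)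
  then obtain f where f: "set_coloring P f"
      "\<And>z. z \<in> P \<Longrightarrow> f z \<subseteq> {..<w z * (2 * N - w z)} \<and> card (f z) = (w z)\<^sup>2"
    by blast
  \<comment> \<open>The reflection moves \<open>f q\<close> from below
    \<open>w q * (2 * N - w q)\<close> to colours that are at least
    \<open>(N - w q)\<^sup>2\<close>. A neighbour \<open>p\<close> of \<open>q\<close> with
    \<open>E y p\<close> only uses colours below \<open>(w p)\<^sup>2\<close>, and
    \<open>w p + w q \<le> N\<close>.\<close>
  define h where "h q = (if E y q then {..<(w q)\<^sup>2} else (\<lambda>n. N\<^sup>2 - 1 - n) ` f q)" for q
  have wN: "w q \<le> N" if "q \<in> Q" for q
    using clique_weight_elem[OF fin that, of w] N by linarith
  have sq: "(N - w q)\<^sup>2 + w q * (2 * N - w q) = N\<^sup>2" if "q \<in> Q" for q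
  proof -
    have "w q \<le> N"
      using wN that .
    then obtain d where "N = w q + d"
      using le_Suc_ex by blast
    then show ?thesis
      by (simp add: power2_eq_square algebra_simps)
  qed
  have fN: "f q \<subseteq> {..<N\<^sup>2}" if "q \<in> P" for q
    using f(2)[OF that] sq[of q] that by (fastforce simp: P_def)
  have inj: "inj_on (\<lambda>n. N\<^sup>2 - 1 - n) {..<N\<^sup>2}"
    by (auto simp: inj_on_def)
  have range: "h q \<subseteq> {..<N\<^sup>2} \<and> card (h q) = (w q)\<^sup>2" if "q \<in> Q" for q
  proof (cases "E y q")
    case True
    then show ?thesis
      using wN[OF that] power_mono[of "w q" N 2] by (auto simp: h_def)
  next
    case False
    then have "q \<in> P"
      using that by (simp add: P_def)
    then have "card ((\<lambda>n. N\<^sup>2 - 1 - n) ` f q) = (w q)\<^sup>2"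
      using f(2) fN inj by (metis card_image inj_on_subset)
    moreover have "(\<lambda>n. N\<^sup>2 - 1 - n) ` f q \<subseteq> {..<N\<^sup>2}"
      using fN[OF \<open>q \<in> P\<close>] by auto
    ultimately show ?thesis
      using False by (simp add: h_def)
  qed
  have cross: "h p \<inter> h q = {}" if pq: "p \<in> Q" "q \<in> Q" "E p q" "E y p" for p q
  proof -
    have yq: "\<not> E y q"
      using stable pq by blast
    have "p \<noteq> q"
      using pq irrefl by blast
    then have "w p + w q \<le> N"
      using clique_weight_ge[OF fin, of "{p, q}" w] pq sym N by (auto simp: clique_def)
    then have "(w p)\<^sup>2 \<le> (N - w q)\<^sup>2"
      by (intro power_mono) auto
    also have "\<dots> \<le> N\<^sup>2 - 1 - n" if "n \<in> f q" for n
    proof -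
      have "n < w q * (2 * N - w q)"
        using f(2)[of q] yq pq that by (auto simp: P_def)
      then show ?thesis
        using sq[OF pq(2)] by linarith
    qed
    finally show ?thesis
      using pq(4) yq by (auto simp: h_def not_less[symmetric])
  qed
  have "set_coloring Q h"
    unfolding set_coloring_def
  proof (intro ballI impI)
    fix p q assume pq: "p \<in> Q" "q \<in> Q" "E p q"
    show "h p \<inter> h q = {}"
    proof (cases "E y p \<or> E y q")
      case True
      then show ?thesis
        using cross[of p q] cross[of q p] pq sym by blast
    next
      case False
      then have P: "p \<in> P" "q \<in> P"
        using pq by (auto simp: P_def)
      then have "f p \<inter> f q = {}"
        using f(1) pq(3) unfolding set_coloring_def by blast
      then show ?thesis
        using False inj_on_image_Int[OF inj fN[OF P(1)] fN[OF P(2)]] by (simp add: h_def)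
    qed
  qed
  then show ?thesis
    using range by blast
qed

section \<open>Colouring the vertices anticomplete to the chosen block\<close>

text \<open>The first alternative in \<open>splits\<close> is meant for modules inside a block of
  the ambient graph. In the second one, \<open>Y\<close> is either decomposable or has a prime
  quotient; its parts or blocks are again modules of \<open>M\<close>, so the induction applies to
  them.\<close>

lemma anticomplete_colorable:
  assumes fin: "finite M" and far: "\<And>p. p \<in> M \<Longrightarrow> \<not> E v p"
    and splits: "\<And>Y. module M Y \<Longrightarrow> Y \<noteq> {} \<Longrightarrow> colorable Y (m * (omega Y)\<^sup>2) \<or>
      (\<exists>y. E v y \<and> (\<exists>a\<in>Y. E y a) \<and> (\<exists>b\<in>Y. \<not> E y b))"
    and "module M Y"
  shows "colorable Y (m * (omega Y)\<^sup>2)"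
  using assms(4)
proof (induction "card Y" arbitrary: Y rule: less_induct)
  case less
  have YM: "Y \<subseteq> M" and finY: "finite Y"
    using less.prems fin unfolding module_def by (auto intro: finite_subset)
  consider "Y = {}" | "colorable Y (m * (omega Y)\<^sup>2)"
    | y where "E v y" "\<exists>a\<in>Y. E y a" "\<exists>b\<in>Y. \<not> E y b"
    using splits[OF less.prems] by blast
  then show ?case
  proof cases
    case 1
    then show ?thesis
      by (simp add: colorable_def)
  next
    case 2
    then show ?thesis .
  next
    case y: 3
    show ?thesis
    proof (cases "decomposable Y")
      case True
      then obtain B C e where BC: "Y = B \<union> C" "B \<inter> C = {}" "B \<noteq> {}" "C \<noteq> {}"
          "\<And>b c. b \<in> B \<Longrightarrow> c \<in> C \<Longrightarrow> E b c \<longleftrightarrow> e"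
        unfolding decomposable_def by blast
      then have mods: "module M B" "module M C"
        using module_const_part[of M B C e] less.prems by blast+
      have cards: "card B < card Y" "card C < card Y"
        using BC finY by (auto intro!: psubset_card_mono)
      note IH = less.hyps[OF cards(1) mods(1)] less.hyps[OF cards(2) mods(2)]
      show ?thesis
      proof (cases e)
        case True
        then have "omega B + omega C \<le> omega Y"
          using BC finY by (intro clique_weight_join) auto
        then have "(omega B)\<^sup>2 + (omega C)\<^sup>2 \<le> (omega Y)\<^sup>2"
          using power_mono[of "omega B + omega C" "omega Y" 2] by (simp add: power2_sum)
        then have "m * (omega B)\<^sup>2 + m * (omega C)\<^sup>2 \<le> m * (omega Y)\<^sup>2"
          by (metis distrib_left mult_le_mono2)
        then show ?thesis
          using colorable_mono[OF colorable_union[OF IH]] BC(1) by blast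
      next
        case False
        have "omega B \<le> omega Y" "omega C \<le> omega Y"
          using BC(1) finY by (auto intro: clique_weight_mono)
        then have "colorable B (m * (omega Y)\<^sup>2)" "colorable C (m * (omega Y)\<^sup>2)"
          using IH by (auto intro: colorable_mono power_mono)
        then show ?thesis
          using colorable_anticomplete_union BC False by blast
      qed
    next
      case False
      have big: "Y \<noteq> {x}" for x
        using y by blast
      note self = self_in_block[OF finY False _ big] and mod = module_block[OF finY False _ big]
        and proper = block_proper[OF finY False _ big] and eq = block_eq[OF finY False _ big]
      have sub: "block Y x \<subseteq> Y" if "x \<in> Y" for x
        using mod[OF that] unfolding module_def by blast
      \<comment> \<open>The representative of a block is a neighbour of \<open>y\<close> whenever
        the block contains one. This ensures that the quotient \<open>Q\<close> contains a neighbour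
        of \<open>y\<close>.\<close>
      have "\<forall>B. \<exists>z. B \<noteq> {} \<longrightarrow> z \<in> B \<and> ((\<exists>a\<in>B. E y a) \<longrightarrow> E y z)"
        by blast
      from choice[OF this] obtain \<rho>
        where \<rho>: "\<forall>B. B \<noteq> {} \<longrightarrow> \<rho> B \<in> B \<and> ((\<exists>a\<in>B. E y a) \<longrightarrow> E y (\<rho> B))"
        by (elim exE)
      define r where "r x = \<rho> (block Y x)" for x
      have r: "r x \<in> block Y x" "r x \<in> Y" and r_y: "E y x \<Longrightarrow> E y (r x)"
        and block_r: "block Y (r x) = block Y x" and r_r: "r (r x) = r x" if "x \<in> Y" for x
      proof -
        show *: "r x \<in> block Y x"
          using \<rho> self[OF that] unfolding r_def by blast
        then show "r x \<in> Y"
          using sub that by blast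
        show "E y x \<Longrightarrow> E y (r x)"
          using \<rho> self[OF that] unfolding r_def by blast
        show "block Y (r x) = block Y x"
          using eq[OF that *] .
        then show "r (r x) = r x"
          by (simp add: r_def)
      qed
      define Q where "Q = r ` Y"
      have QY: "Q \<subseteq> Y" and rQ: "\<And>q. q \<in> Q \<Longrightarrow> r q = q"
        using r r_r by (auto simp: Q_def)
      have r_eq: "r x = r z \<longleftrightarrow> z \<in> block Y x" if "x \<in> Y" "z \<in> Y" for x z
        using that eq[of x z] self[of z] block_r by (metis r_def)
      have adj: "E x z \<longleftrightarrow> E (r x) (r z)" if "x \<in> Y" "z \<in> Y" "r x \<noteq> r z" for x z
      proof -
        have "x \<notin> block Y z" "r z \<notin> block Y x"
          using that r_eq[of z x] r_eq[of x "r z"] r r_r by auto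
        then have "E x z \<longleftrightarrow> E x (r z)" "E (r z) x \<longleftrightarrow> E (r z) (r x)"
          using mod[OF that(1)] mod[OF that(2)] self r that unfolding module_def by blast+
        then show ?thesis
          using sym by blast
      qed
      define B where "B q = block Y q" for q
      define w where "w q = omega (B q)" for q
      have B: "B q \<subseteq> Y" "q \<in> B q" "module M (B q)" "card (B q) < card Y" if "q \<in> Q" for q
      proof -
        have q: "q \<in> Y"
          using that QY by blast
        show "B q \<subseteq> Y" "q \<in> B q" "module M (B q)"
          using sub[OF q] self[OF q] module_trans[OF less.prems mod[OF q]] by (simp_all add: B_def)
        then show "card (B q) < card Y"
          using proper[OF q] finY by (intro psubset_card_mono) (auto simp: B_def)
      qed
      have fiber: "{x \<in> Y. r x = q} = B q" if "q \<in> Q" for q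
        using r_eq[of q] rQ[OF that] that QY sub[of q] unfolding B_def by fastforce
      have "\<exists>f. set_coloring Q f \<and> (\<forall>q\<in>Q. f q \<subseteq> {..<(omega Y)\<^sup>2} \<and> card (f q) = (w q)\<^sup>2)"
      proof (rule prime_set_coloring[of Q w v y])
        show "finite Q"
          using finY by (simp add: Q_def)
        show "1 \<le> w q" if "q \<in> Q" for q
          using clique_weight_elem[of "B q" q "\<lambda>_. 1"] B[OF that] finY finite_subset
          unfolding w_def by blast
        show "E v y"
          by fact
        show "\<not> E v q" if "q \<in> Q" for q
          using far QY YM that by blast
        show "\<exists>q\<in>Q. E y q"
          using y(2) r_y by (auto simp: Q_def)
        show "clique_weight w Q \<le> omega Y"
          unfolding w_def
        proof (rule clique_weight_substitution)
          show "E x z" if "p \<in> Q" "q \<in> Q" "E p q" "x \<in> B p" "z \<in> B q" for p q x z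
          proof -
            have "r x = p" "r z = q" "x \<in> Y" "z \<in> Y" "p \<noteq> q"
              using fiber that irrefl by blast+
            then show ?thesis
              using adj that(3) by blast
          qed
        qed (use finY B Q_def in auto)
        show "\<not> E p q" if pq: "p \<in> Q" "q \<in> Q" "E y p" "E y q" for p q
        proof
          assume "E p q"
          \<comment> \<open>\<open>Z\<close> is the component of \<open>p\<close> among the
            neighbours of \<open>y\<close> in \<open>Y\<close>. It turns out to be a module, proper
            because \<open>y\<close> has a non-neighbour in \<open>Y\<close>. So it lies in one
            block, although \<open>p\<close> and \<open>q\<close> represent different
            blocks.\<close>
          define T where "T = {(a, b). a \<in> Y \<and> b \<in> Y \<and> E y a \<and> E y b \<and> E a b}"
          define Z where "Z = {z. (p, z) \<in> T\<^sup>*}"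
          have ZY: "z \<in> Y \<and> E y z" if "z \<in> Z" for z
          proof -
            have "(p, z) \<in> T\<^sup>*"
              using that by (simp add: Z_def)
            then show ?thesis
              by (induction rule: rtrancl_induct) (use pq QY in \<open>auto simp: T_def\<close>)
          qed
          have Z_step: "b \<in> Z" if "a \<in> Z" "(a, b) \<in> T" for a b
            using that by (auto simp: Z_def intro: rtrancl_into_rtrancl)
          \<comment> \<open>Otherwise the triangle \<open>y, a, b\<close> with pendant vertices
            \<open>v\<close> at \<open>y\<close> and \<open>d\<close> at \<open>a\<close> is a
            bull.\<close>
          have transfer: "E d b" if "(a, b) \<in> T" "d \<in> Y" "\<not> E y d" "E d a" for a b d
            using bull_free[of y a b v d] that far YM y(1) sym unfolding T_def by blast
          have to_p: "E d z \<longleftrightarrow> E d p" if "z \<in> Z" "d \<in> Y" "\<not> E y d" for d z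
          proof -
            have "(p, z) \<in> T\<^sup>*"
              using that by (simp add: Z_def)
            then show ?thesis
            proof (induction rule: rtrancl_induct)
              case (step a b)
              moreover have "(b, a) \<in> T"
                using step.hyps(2) by (auto simp: T_def sym)
              ultimately show ?case
                using transfer that by blast
            qed simp
          qed
          have "E d a \<longleftrightarrow> E d b" if d: "d \<in> Y - Z" and ab: "a \<in> Z" "b \<in> Z" for d a b
          proof (cases "E y d")
            case False
            then show ?thesis
              using to_p d ab by blast
          next
            case True
            have "\<not> E d u" if "u \<in> Z" for u
              using Z_step[OF that, of d] ZY[OF that] True d sym unfolding T_def by blast
            then show ?thesis
              using ab by blast
          qed
          then have "module Y Z"
            using ZY unfolding module_def by blast
          moreover have "Z \<noteq> Y"
            using ZY y(3) by blast
          moreover have "p \<in> Z"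
            by (simp add: Z_def)
          moreover from this have "q \<in> Z"
            using pq QY \<open>E p q\<close> Z_step unfolding T_def by blast
          ultimately have "q \<in> block Y p"
            using module_subset_block by blast
          then have "r p = r q"
            using r_eq pq QY by blast
          then show False
            using rQ pq \<open>E p q\<close> irrefl by metis
        qed
        show "X = Q" if X: "module Q X" "2 \<le> card X" for X
        proof -
          \<comment> \<open>The union of the blocks represented in \<open>X\<close> is a module of
            \<open>Y\<close>. It meets two blocks, so by maximality of the blocks it is all of
            \<open>Y\<close>.\<close>
          define U where "U = {x \<in> Y. r x \<in> X}"
          have XQ: "X \<subseteq> Q"
            using X(1) unfolding module_def by blast
          then have XU: "X \<subseteq> U"
            using QY rQ by (auto simp: U_def)
          have "E z a \<longleftrightarrow> E z b" if z: "z \<in> Y - U" and ab: "a \<in> U" "b \<in> U" for z a b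
          proof -
            have "r z \<in> Q - X"
              using z by (auto simp: U_def Q_def)
            then have "E (r z) (r a) \<longleftrightarrow> E (r z) (r b)"
              using X(1) ab unfolding module_def U_def by blast
            moreover have "r z \<noteq> r a" "r z \<noteq> r b"
              using z ab by (auto simp: U_def)
            ultimately show ?thesis
              using adj[of z a] adj[of z b] z ab by (auto simp: U_def)
          qed
          moreover have "U \<subseteq> Y"
            by (auto simp: U_def)
          ultimately have "module Y U"
            unfolding module_def by blast
          have "\<not> card X \<le> Suc 0" "finite X"
            using X(2) by (auto intro: card_ge_0_finite)
          then obtain p q where pq: "p \<in> X" "q \<in> X" "p \<noteq> q"
            using card_le_Suc0_iff_eq by blast
          have "q \<notin> block Y p"
            using pq r_eq[of p q] rQ XQ QY by (metis subsetD)
          then have "U = Y"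
            using module_subset_block[OF \<open>module Y U\<close>] pq XU by blast
          have "q \<in> X" if "q \<in> Q" for q
            using rQ[OF that] QY that \<open>U = Y\<close> unfolding U_def by force
          then show ?thesis
            using XQ by blast
        qed
      qed
      then obtain f where f: "set_coloring Q f"
          "\<And>q. q \<in> Q \<Longrightarrow> f q \<subseteq> {..<(omega Y)\<^sup>2}" "\<And>q. q \<in> Q \<Longrightarrow> card (f q) = (w q)\<^sup>2"
        by blast
      \<comment> \<open>By induction the block of \<open>q\<close> needs
        \<open>m * (w q)\<^sup>2\<close> colours, that is \<open>m\<close> for each element of
        \<open>f q\<close>.\<close>
      have "colorable Y ((omega Y)\<^sup>2 * m)"
      proof (rule colorable_substitution[of Y r Q f m])
        show "colorable {x \<in> Y. r x = q} (card (f q) * m)" if "q \<in> Q" for q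
          using less.hyps[OF B(4)[OF that] B(3)[OF that]] f(3)[OF that] fiber[OF that]
          by (simp add: w_def mult.commute)
      qed (use f adj in \<open>auto simp: Q_def\<close>)
      then show ?thesis
        by (simp add: mult.commute)
    qed
  qed
qed

section \<open>The cubic bound\<close>

lemma colorable_cube:
  assumes "finite A"
  shows "colorable A ((omega A) ^ 3)"
  using assms
proof (induction "card A" arbitrary: A rule: less_induct)
  case less
  note fin = less.prems
  have IH: "colorable B ((omega B) ^ 3)" if "B \<subset> A" for B
    using less.hyps[of B] that fin psubset_card_mono finite_subset by blast
  consider "A = {}" | x where "A = {x}" | "decomposable A"
    | "A \<noteq> {}" "\<not> decomposable A" "\<And>x. A \<noteq> {x}"
    by blast
  then show ?case
  proof cases
    case 1
    then show ?thesis
      by (simp add: colorable_def)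
  next
    case 2
    then have "1 \<le> omega A"
      using clique_weight_elem[of A x "\<lambda>_. 1"] by simp
    moreover have "colorable A 1"
      unfolding colorable_def using 2 irrefl by (intro exI[of _ "\<lambda>_. 0"]) simp
    ultimately show ?thesis
      using colorable_mono[of A 1] by (simp add: Suc_le_eq)
  next
    case 3
    then obtain B C e where BC: "A = B \<union> C" "B \<inter> C = {}" "B \<noteq> {}" "C \<noteq> {}"
        "\<And>b c. b \<in> B \<Longrightarrow> c \<in> C \<Longrightarrow> E b c \<longleftrightarrow> e"
      unfolding decomposable_def by blast
    then have col: "colorable B ((omega B) ^ 3)" "colorable C ((omega C) ^ 3)"
      using IH by blast+
    show ?thesis
    proof (cases e)
      case True
      then have "omega B + omega C \<le> omega A"
        using BC fin by (intro clique_weight_join) auto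
      then have "(omega B + omega C) ^ 3 \<le> (omega A) ^ 3"
        by (rule power_mono) simp
      then have "(omega B) ^ 3 + (omega C) ^ 3 \<le> (omega A) ^ 3"
        by (simp add: power3_eq_cube algebra_simps)
      then show ?thesis
        using colorable_mono[OF colorable_union[OF col]] BC(1) by blast
    next
      case False
      have "omega B \<le> omega A" "omega C \<le> omega A"
        using BC(1) fin by (auto intro: clique_weight_mono)
      then have "colorable B ((omega A) ^ 3)" "colorable C ((omega A) ^ 3)"
        using col by (auto intro: colorable_mono power_mono)
      then show ?thesis
        using colorable_anticomplete_union BC False by blast
    qed
  next
    case 4
    define g where "g x = omega (block A x)" for x
    \<comment> \<open>The choice of \<open>v\<close> gives \<open>omega Y \<le> m\<close> for every
      \<open>Y\<close> inside a block, so the \<open>(omega Y) ^ 3\<close> colours from the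
      induction hypothesis are at most \<open>m * (omega Y)\<^sup>2\<close>.\<close>
    have "Max (g ` A) \<in> g ` A"
      using fin 4(1) by (intro Max_in) auto
    then obtain v where v: "v \<in> A" "g v = Max (g ` A)"
      by auto
    have g_le: "g x \<le> g v" if "x \<in> A" for x
      using that v(2) fin by simp
    have big: "A \<noteq> {x}" for x
      using 4(3) by blast
    define X where "X = block A v"
    define m where "m = omega X"
    have X: "v \<in> X" "module A X" "X \<noteq> A"
      using self_in_block[OF fin 4(2) v(1) big] module_block[OF fin 4(2) v(1) big]
        block_proper[OF fin 4(2) v(1) big] by (simp_all add: X_def)
    have XA: "X \<subseteq> A"
      using X(2) unfolding module_def by blast
    define N where "N = {u \<in> A - X. E v u}"
    define M where "M = {u \<in> A - X. \<not> E v u}"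
    have A: "A = N \<union> (X \<union> M)"
      using XA by (auto simp: N_def M_def)
    have XN: "E u x" if "u \<in> N" "x \<in> X" for u x
      using that X(1,2) sym unfolding module_def N_def by blast
    have XM: "\<not> E u x" if "u \<in> M" "x \<in> X" for u x
      using that X(1,2) sym unfolding module_def M_def by blast
    have sum_le: "omega N + m \<le> omega A"
      unfolding m_def using XN XA fin
      by (intro clique_weight_join) (auto simp: N_def intro: finite_subset)
    have "N \<subset> A"
      using v(1) X(1) by (auto simp: N_def)
    then have colN: "colorable N ((omega N) ^ 3)"
      by (rule IH)
    have "colorable M (m * (omega M)\<^sup>2)"
    proof (rule anticomplete_colorable[of M v])
      show "finite M"
        using fin by (simp add: M_def)
      show "\<not> E v p" if "p \<in> M" for p
        using that by (simp add: M_def)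
      show "module M M"
        by (simp add: module_def)
      fix Y assume Y: "module M Y" "Y \<noteq> {}"
      then obtain x where x: "x \<in> Y"
        by blast
      have YM: "Y \<subseteq> M"
        using Y(1) unfolding module_def by blast
      then have YA: "Y \<subset> A" "x \<in> A"
        using v(1) X(1) x by (auto simp: M_def)
      show "colorable Y (m * (omega Y)\<^sup>2) \<or>
        (\<exists>y. E v y \<and> (\<exists>a\<in>Y. E y a) \<and> (\<exists>b\<in>Y. \<not> E y b))"
      proof (cases "Y \<subseteq> block A x")
        case True
        have "finite (block A x)"
          using module_block[OF fin 4(2) YA(2) big] fin finite_subset unfolding module_def by blast
        then have "omega Y \<le> g x"
          unfolding g_def using clique_weight_mono True by blast
        also have "\<dots> \<le> m"
          using g_le[OF YA(2)] by (simp add: m_def g_def X_def)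
        finally have "(omega Y) ^ 3 \<le> m * (omega Y)\<^sup>2"
          by (simp add: power3_eq_cube power2_eq_square)
        then show ?thesis
          using colorable_mono[OF IH[OF YA(1)]] by blast
      next
        case False
        \<comment> \<open>A vertex \<open>y\<close> splitting \<open>Y\<close> is not in
          \<open>M\<close>, where \<open>Y\<close> is a module, and not in \<open>X\<close>, which
          is anticomplete to \<open>M\<close>. So it lies in \<open>N\<close>.\<close>
        then have "\<not> module A Y"
          using module_subset_block x YA(1) by blast
        then obtain y a b where y: "y \<in> A - Y" "a \<in> Y" "b \<in> Y" "E y a" "\<not> E y b"
          using YA(1) unfolding module_def by blast
        then have "y \<notin> M"
          using Y(1) unfolding module_def by blast
        moreover have "y \<notin> X"
          using XM y YM sym by blast
        ultimately have "E v y"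
          using y(1) by (simp add: M_def)
        then show ?thesis
          using y by blast
      qed
    qed
    moreover have "m * (omega M)\<^sup>2 \<le> m * (omega A)\<^sup>2"
      using fin by (intro mult_le_mono2 power_mono clique_weight_mono) (auto simp: M_def)
    ultimately have colM: "colorable M (m * (omega A)\<^sup>2)"
      using colorable_mono by blast
    \<comment> \<open>\<open>X\<close> and \<open>M\<close> are anticomplete, so the same
      \<open>m * (omega A)\<^sup>2\<close> colours serve for both.\<close>
    have "m ^ 3 = m * m\<^sup>2"
      by (simp add: power3_eq_cube power2_eq_square)
    also have "\<dots> \<le> m * (omega A)\<^sup>2"
      using sum_le by (intro mult_le_mono2 power_mono) auto
    finally have "colorable X (m * (omega A)\<^sup>2)"
      using colorable_mono[OF IH[of X]] XA X(3) unfolding m_def by blast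
    then have "colorable (X \<union> M) (m * (omega A)\<^sup>2)"
      using colorable_anticomplete_union[OF _ colM] XM sym by blast
    then have "colorable A ((omega N) ^ 3 + m * (omega A)\<^sup>2)"
      unfolding A[symmetric] using colorable_union[OF colN] A by metis
    moreover have "(omega N) ^ 3 + m * (omega A)\<^sup>2 \<le> (omega A) ^ 3"
    proof -
      have "(omega N) ^ 3 = omega N * (omega N)\<^sup>2"
        by (simp add: power3_eq_cube power2_eq_square)
      also have "\<dots> \<le> omega N * (omega A)\<^sup>2"
        using sum_le by (intro mult_le_mono2 power_mono) auto
      finally have "(omega N) ^ 3 + m * (omega A)\<^sup>2 \<le> (omega N + m) * (omega A)\<^sup>2"
        by (simp add: distrib_right)
      also have "\<dots> \<le> omega A * (omega A)\<^sup>2"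
        using sum_le by (rule mult_le_mono1)
      finally show ?thesis
        by (simp add: power3_eq_cube power2_eq_square)
    qed
    ultimately show ?thesis
      using colorable_mono by blast
  qed
qed

end

section \<open>Transfer to digraphs and the final bound\<close>

lemma parcs_path_graph_iff:
  "(u, w) \<in> parcs (path_graph n) \<longleftrightarrow> (w = Suc u \<and> w < n) \<or> (u = Suc w \<and> u < n)"
  by (auto simp: path_graph_def mk_symmetric_def)

lemma parcs_bull_graph:
  "parcs bull_graph = {(0, 1), (1, 2), (0, 2), (0, 3), (1, 4), (1, 0), (2, 1), (2, 0), (3, 0), (4, 1)}"
  by (auto simp: bull_graph_def mk_symmetric_def)

text \<open>With the embedding written as a list, the adjacency condition becomes a finite check
  over indices that simplification can unfold.\<close>

lemma not_induced_free_list: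
  assumes "graph G" "graph (with_proj H)" "pverts H = {..<length xs}"
    and "distinct xs" "set xs \<subseteq> verts G"
    and "\<forall>i<length xs. \<forall>j<length xs. i \<rightarrow>\<^bsub>with_proj H\<^esub> j \<longleftrightarrow> xs ! i \<rightarrow>\<^bsub>G\<^esub> xs ! j"
  shows "\<not> induced_free G (with_proj H)"
  unfolding not_induced_free_iff[OF assms(1,2)]
proof (intro exI[of _ "(!) xs"] conjI)
  show "inj_on ((!) xs) (verts (with_proj H))"
    using assms(3,4) by (auto simp: inj_on_def nth_eq_iff_index_eq)
  show "(!) xs ` verts (with_proj H) \<subseteq> verts G"
    using assms(3,5) by auto
qed (use assms(3,6) in auto)

theorem theorem1p7:
  fixes G :: "('a, 'b) pre_digraph"
  assumes "graph G"
    and "induced_free G (with_proj (path_graph 6))"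
    and "induced_free G (with_proj bull_graph)"
  shows "chromatic_number G \<le> clique_number G ^ 7"
proof -
  interpret G: graph G
    by fact
  have sym: "v \<rightarrow>\<^bsub>G\<^esub> u \<longleftrightarrow> u \<rightarrow>\<^bsub>G\<^esub> v" for u v
    using arcs_ends_symmetric[OF G.sym_arcs] by blast
  have irrefl: "\<not> u \<rightarrow>\<^bsub>G\<^esub> u" for u
    using G.adj_not_same by blast
  interpret bull_P6_free "\<lambda>u v. u \<rightarrow>\<^bsub>G\<^esub> v"
  proof
    show "v \<rightarrow>\<^bsub>G\<^esub> u" if "u \<rightarrow>\<^bsub>G\<^esub> v" for u v
      using that sym by blast
    show "\<not> u \<rightarrow>\<^bsub>G\<^esub> u" for u
      by (rule irrefl)
  next
    fix a b c d e
    assume e: "a \<rightarrow>\<^bsub>G\<^esub> b" "b \<rightarrow>\<^bsub>G\<^esub> c" "a \<rightarrow>\<^bsub>G\<^esub> c" "a \<rightarrow>\<^bsub>G\<^esub> d" "b \<rightarrow>\<^bsub>G\<^esub> e"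
      and n: "\<not> c \<rightarrow>\<^bsub>G\<^esub> d" "\<not> c \<rightarrow>\<^bsub>G\<^esub> e" "\<not> d \<rightarrow>\<^bsub>G\<^esub> e" "\<not> a \<rightarrow>\<^bsub>G\<^esub> e" "\<not> b \<rightarrow>\<^bsub>G\<^esub> d"
    have "\<not> induced_free G (with_proj bull_graph)"
    proof (rule not_induced_free_list[OF assms(1) graph_bull_graph, of "[a, b, c, d, e]"])
      show "pverts bull_graph = {..<length [a, b, c, d, e]}"
        by (simp add: bull_graph_def mk_symmetric_def)
      show "distinct [a, b, c, d, e]"
        using e n irrefl sym by auto
      show "set [a, b, c, d, e] \<subseteq> verts G"
        using e G.adj_in_verts by auto
    qed (use e n in \<open>simp add: parcs_bull_graph All_less_Suc2 numeral_eq_Suc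
        irrefl sym[of b a] sym[of c b] sym[of c a] sym[of d a] sym[of e b]
        sym[of d c] sym[of e c] sym[of e d] sym[of e a] sym[of d b]\<close>)
    then show False
      using assms(3) by blast
  next
    fix a b c d e f
    assume e: "a \<rightarrow>\<^bsub>G\<^esub> b" "b \<rightarrow>\<^bsub>G\<^esub> c" "c \<rightarrow>\<^bsub>G\<^esub> d" "d \<rightarrow>\<^bsub>G\<^esub> e" "e \<rightarrow>\<^bsub>G\<^esub> f"
      and n: "\<not> a \<rightarrow>\<^bsub>G\<^esub> c" "\<not> a \<rightarrow>\<^bsub>G\<^esub> d" "\<not> a \<rightarrow>\<^bsub>G\<^esub> e" "\<not> a \<rightarrow>\<^bsub>G\<^esub> f" "\<not> b \<rightarrow>\<^bsub>G\<^esub> d"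
        "\<not> b \<rightarrow>\<^bsub>G\<^esub> e" "\<not> b \<rightarrow>\<^bsub>G\<^esub> f" "\<not> c \<rightarrow>\<^bsub>G\<^esub> e" "\<not> c \<rightarrow>\<^bsub>G\<^esub> f" "\<not> d \<rightarrow>\<^bsub>G\<^esub> f"
    have "\<not> induced_free G (with_proj (path_graph 6))"
    proof (rule not_induced_free_list[OF assms(1) graph_path_graph, of _ "[a, b, c, d, e, f]"])
      show "pverts (path_graph 6) = {..<length [a, b, c, d, e, f]}"
        by (simp add: path_graph_def mk_symmetric_def)
      show "distinct [a, b, c, d, e, f]"
        using e n irrefl sym by auto
      show "set [a, b, c, d, e, f] \<subseteq> verts G"
        using e G.adj_in_verts by auto
    qed (use e n in \<open>simp add: parcs_path_graph_iff All_less_Suc2 numeral_eq_Suc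
        irrefl sym[of b a] sym[of c b] sym[of d c] sym[of e d] sym[of f e]
        sym[of c a] sym[of d a] sym[of e a] sym[of f a] sym[of d b] sym[of e b] sym[of f b]
        sym[of e c] sym[of f c] sym[of f d]\<close>)
    then show False
      using assms(2) by blast
  qed
  obtain K where K: "K \<subseteq> verts G" "clique K" "card K = omega (verts G)"
    using clique_weight_attained[OF G.finite_verts, of "\<lambda>_. 1"] by (metis card_eq_sum)
  then have "is_clique G K"
    by (simp add: is_clique_def clique_def)
  then have omega: "omega (verts G) \<le> clique_number G"
    using clique_number_attained(2)[OF assms(1)] K(3) by metis
  obtain c where "\<forall>x\<in>verts G. c x < omega (verts G) ^ 3"
      "\<forall>x\<in>verts G. \<forall>y\<in>verts G. x \<rightarrow>\<^bsub>G\<^esub> y \<longrightarrow> c x \<noteq> c y"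
    using colorable_cube[OF G.finite_verts] unfolding colorable_def by blast
  then have "proper_coloring G (omega (verts G) ^ 3) c"
    unfolding proper_coloring_def using G.adj_in_verts by blast
  then have "chromatic_number G \<le> omega (verts G) ^ 3"
    unfolding chromatic_number_def by (intro Least_le exI)
  also have "\<dots> \<le> clique_number G ^ 3"
    using omega by (rule power_mono) simp
  \<comment> \<open>Raising the exponent requires a base of at least 1; for the null graph both
    powers are 0.\<close>
  also have "\<dots> \<le> clique_number G ^ 7"
    by (cases "clique_number G = 0") (auto intro: power_increasing)
  finally show ?thesis .
qed

end
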